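(* Let $r > 0$ and $l \ge 0$ be real numbers and let $n \ge 1$ be an integer with $\lceil r\rceil \le n$. Then there is a set, of cardinality $\beth_2 = 2^{2^{\aleph_0}}$, of (pairwise distinct) fractals $F \subseteq \mathbb{R}^n$, each of which has Lebesgue measure $\lambda_n(F) = l$ and Hausdorff dimension $\dim_H(F) = 1_{\{0\}}(l)\cdot r + 1_{(0,\infty)}(l)\cdot n$ (that is, $\dim_H(F)=r$ if $l=0$, and $\dim_H(F)=n$ if $l>0$).
   Context: $\mathbb{R}^n$ carries its Euclidean metric and $\lambda_n$ denotes $n$-dimensional Lebesgue measure; $1_A$ is the indicator function of $A$. Hausdorff dimension: for $C \subseteq \mathbb{R}^n$ and $s \ge 0$, $H^s(C) = \lim_{\delta\to 0}\inf\{\sum_{i\in\mathbb{N}} |U_i|^s : C \subseteq \bigcup_{i\in\mathbb{N}} U_i,\ 0<|U_i|\le\delta\}$, where $|U|$ is the diameter of $U$, and $\dim_H(C) = \inf\{s \ge 0 : H^s(C) = 0\}$. Topological dimension: $\dim_{ind}$ is the Urysohn–Menger small inductive dimension, defined inductively for subspaces $C\subseteq\mathbb{R}^n$ by $\dim_{ind}(\emptyset) = -1$; $\dim_{ind}(C) \le k$ if $C$ has a base $(U_i)_{i\in I}$ of open sets (in the topology of $C$) whose boundaries in $C$ satisfy $\dim_{ind}(\partial U_i) \le k-1$ for all $i \in I$; and $\dim_{ind}(C) = k$ if $\dim_{ind}(C)\le k$ but not $\dim_{ind}(C)\le k-1$. Fractal (Mandelbrot): a subset $C \subseteq \mathbb{R}^n$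 is a fractal if $\dim_H(C) > \dim_{ind}(C)$. *)

theory Defs
  imports "HOL-Analysis.Analysis"
begin

text \<open>
  Covers are required to be bounded because \<^const>\<open>diameter\<close> is a real supremum and hence
  meaningless on unbounded sets, whose diameter is \<open>\<infinity>\<close> and so never at most \<open>\<delta>\<close>.
\<close>

definition hausdorff_covers :: "real \<Rightarrow> 'a::metric_space set \<Rightarrow> (nat \<Rightarrow> 'a set) set" where
  "hausdorff_covers \<delta> C =
     {U. C \<subseteq> (\<Union>i. U i) \<and> (\<forall>i. bounded (U i) \<and> 0 < diameter (U i) \<and> diameter (U i) \<le> \<delta>)}"

definition hausdorff_premeasure :: "real \<Rightarrow> real \<Rightarrow> 'a::metric_space set \<Rightarrow> ennreal" where
  "hausdorff_premeasure \<delta> s C =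
     (INF U\<in>hausdorff_covers \<delta> C. \<Sum>i. ennreal (diameter (U i) powr s))"

definition hausdorff_measure :: "real \<Rightarrow> 'a::metric_space set \<Rightarrow> ennreal" where
  "hausdorff_measure s C = Lim (at_right 0) (\<lambda>\<delta>. hausdorff_premeasure \<delta> s C)"

definition dim_H :: "'a::metric_space set \<Rightarrow> ereal" where
  "dim_H C = (INF s\<in>{s. 0 \<le> s \<and> hausdorff_measure s C = 0}. ereal s)"

text \<open>
  The relation \<^const>\<open>dimension_le\<close> (written \<open>X dim_le k\<close>) is the small inductive dimension
  bound for a topological space; \<open>dimension_le_base\<close> and \<open>dim_ind_eq_iff\<close> below relate it and
  \<open>dim_ind\<close> to the usual formulation by bases. The value of \<open>dim_ind\<close> is \<open>\<infinity>\<close> if no bound exists.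
\<close>

definition dim_ind :: "'a::topological_space set \<Rightarrow> ereal" where
  "dim_ind C = (INF k\<in>{k::int. top_of_set C dim_le k}. ereal (of_int k))"

definition fractal :: "'a::metric_space set \<Rightarrow> bool" where
  "fractal C \<longleftrightarrow> dim_ind C < dim_H C"

lemma hausdorff_premeasure_antimono:
  "\<delta> \<le> \<epsilon> \<Longrightarrow> hausdorff_premeasure \<epsilon> s C \<le> hausdorff_premeasure \<delta> s C"
  unfolding hausdorff_premeasure_def hausdorff_covers_def
  by (rule INF_superset_mono) (auto intro: order_trans)

lemma hausdorff_premeasure_tendsto:
  "((\<lambda>\<delta>. hausdorff_premeasure \<delta> s C) \<longlongrightarrow> (SUP \<delta>\<in>{0<..}. hausdorff_premeasure \<delta> s C)) (at_right 0)"
proof (rule order_tendstoI)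
  fix a assume "a < (SUP \<delta>\<in>{0<..}. hausdorff_premeasure \<delta> s C)"
  then obtain d where d: "d > 0" "a < hausdorff_premeasure d s C"
    by (auto simp: less_SUP_iff)
  have "a < hausdorff_premeasure \<delta> s C" if "0 < \<delta>" "\<delta> < d" for \<delta>
    using d hausdorff_premeasure_antimono[of \<delta> d s C] that by (meson less_imp_le less_le_trans)
  then show "\<forall>\<^sub>F \<delta> in at_right 0. a < hausdorff_premeasure \<delta> s C"
    using d(1) unfolding eventually_at_right_field by blast
next
  fix a assume a: "(SUP \<delta>\<in>{0<..}. hausdorff_premeasure \<delta> s C) < a"
  have "hausdorff_premeasure \<delta> s C < a" if "0 < \<delta>" for \<delta>
    using a that by (meson SUP_upper greaterThan_iff le_less_trans)
  then show "\<forall>\<^sub>F \<delta> in at_right 0. hausdorff_premeasure \<delta> s C < a"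
    unfolding eventually_at_right_field by (auto intro: exI[of _ 1])
qed

lemma hausdorff_measure_eq_SUP:
  "hausdorff_measure s C = (SUP \<delta>\<in>{0<..}. hausdorff_premeasure \<delta> s C)"
  unfolding hausdorff_measure_def
  by (rule tendsto_Lim[OF _ hausdorff_premeasure_tendsto]) simp

lemma dimension_le_base:
  assumes "0 \<le> k"
  shows "X dim_le k \<longleftrightarrow>
    (\<exists>B. openin X = arbitrary union_of (\<lambda>U. U \<in> B) \<and>
         (\<forall>U\<in>B. subtopology X (X frontier_of U) dim_le (k - 1)))" (is "?L \<longleftrightarrow> ?R")
proof
  assume L: ?L
  let ?B = "{U. openin X U \<and> subtopology X (X frontier_of U) dim_le (k - 1)}"
  have "openin X = arbitrary union_of (\<lambda>U. U \<in> ?B)"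
    unfolding openin_topology_base_unique
    using L by (auto elim!: dimension_le.cases) blast
  then show ?R
    by (intro exI[of _ ?B]) auto
next
  assume ?R
  then obtain B where B: "openin X = arbitrary union_of (\<lambda>U. U \<in> B)"
    "\<And>U. U \<in> B \<Longrightarrow> subtopology X (X frontier_of U) dim_le (k - 1)" by blast
  show ?L
  proof (rule dimension_le.intros)
    fix V a assume "openin X V" "a \<in> V"
    then show "\<exists>U. a \<in> U \<and> U \<subseteq> V \<and> openin X U \<and> subtopology X (X frontier_of U) dim_le (k - 1)"
      using B unfolding openin_topology_base_unique by metis
  qed (use assms in auto)
qed

lemma dim_ind_eq_iff:
  "dim_ind C = ereal (of_int k) \<longleftrightarrow> top_of_set C dim_le k \<and> \<not> top_of_set C dim_le (k - 1)"
proof -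
  have *: "dim_ind C = ereal (of_int m)"
    if m: "top_of_set C dim_le m" "\<not> top_of_set C dim_le (m - 1)" for m
    unfolding dim_ind_def
  proof (rule antisym)
    show "(INF k\<in>{k. top_of_set C dim_le k}. ereal (real_of_int k)) \<le> ereal (of_int m)"
      using m by (auto intro!: INF_lower)
    show "ereal (of_int m) \<le> (INF k\<in>{k. top_of_set C dim_le k}. ereal (real_of_int k))"
    proof (rule INF_greatest)
      fix j assume "j \<in> {k. top_of_set C dim_le k}"
      then have "\<not> j \<le> m - 1" using m(2) dimension_le_mono by blast
      then show "ereal (of_int m) \<le> ereal (of_int j)" by simp
    qed
  qed
  show ?thesis
  proof
    assume k: "dim_ind C = ereal (of_int k)"
    then obtain j where j: "top_of_set C dim_le j"
      unfolding dim_ind_def by (cases "{k. top_of_set C dim_le k} = {}") (auto simp: top_ereal_def)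
    define S where "S = {i::nat. top_of_set C dim_le (int i - 1)}"
    have "nat (j + 1) \<in> S"
      using j dimension_le_bound[OF j] by (simp add: S_def)
    then have L: "(LEAST i. i \<in> S) \<in> S" by (rule LeastI)
    define m where "m = int (LEAST i. i \<in> S) - 1"
    have m: "top_of_set C dim_le m" using L by (simp add: S_def m_def)
    have "\<not> top_of_set C dim_le (m - 1)"
    proof
      assume A: "top_of_set C dim_le (m - 1)"
      then have "nat m \<in> S" "-1 \<le> m - 1"
        using dimension_le_bound[OF A] by (auto simp: S_def)
      then show False
        using Least_le[of "\<lambda>i. i \<in> S" "nat m"] by (simp add: m_def)
    qed
    with m *[of m] k have "m = k" by simp
    with m \<open>\<not> top_of_set C dim_le (m - 1)\<close>
    show "top_of_set C dim_le k \<and> \<not> top_of_set C dim_le (k - 1)" by simp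
  qed (use * in blast)
qed

end

theory Submission
  imports Defs "HOL-Real_Asymp.Real_Asymp"
begin

text \<open>
  For \<open>l = 0\<close>, put \<open>\<beta> = n / r\<close> and let \<open>E\<close> be the \<open>n\<close>-th power of the set of subset sums
  of the weights \<open>c k = 2 powr (- \<beta> k) / (k + 1)\<close>. The \<open>2 ^ (n (k + 1))\<close> points with digits only
  at positions up to \<open>k\<close> give covers showing that \<open>E\<close> is null for \<open>H^r\<close>. As \<open>c k\<close> exceeds the
  sum of all later weights by about \<open>c k / k\<close>, replacing \<open>c k\<close> by \<open>2 ^ - (k + 1)\<close> maps \<open>E\<close> onto
  the unit cube with every Hoelder exponent below \<open>r / n\<close>, so \<open>E\<close> cannot be null for \<open>H^s\<close>
  with \<open>s < r\<close>. The same holds for the part \<open>B\<close> of \<open>E\<close> where all leading digits vanish, and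
  \<open>E - B\<close> contains a copy of the power set of the naturals; any of its
  \<open>2 ^ 2 ^ \<aleph>\<^sub>0\<close> subsets may be added to \<open>B\<close>.

  For \<open>l > 0\<close>, the role of \<open>B\<close> is played by a cube of volume \<open>l\<close>, minus that copy and
  minus all hyperplanes on which some coordinate lies in a suitable countable dense set.

  In both cases each coordinate avoids a dense set of reals, so boxes with endpoints in
  that set form a clopen base, and the small inductive dimension is at most \<open>0\<close>.
\<close>

section \<open>Null sets of Hausdorff measures\<close>

text \<open>
  Radius \<open>0\<close> is allowed and contributes nothing, since \<open>0 powr s = 0\<close>; this pads finite covers.
  No bound on the radii is needed: for \<open>s > 0\<close> a small sum forces them to be small.
\<close>

definition hausdorff_null :: "real \<Rightarrow> 'a::metric_space set \<Rightarrow> bool" where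
  "hausdorff_null s C \<longleftrightarrow>
     (\<forall>e>0. \<exists>x d. (\<forall>i::nat. 0 \<le> d i) \<and> C \<subseteq> (\<Union>i. cball (x i) (d i)) \<and>
        (\<Sum>i. ennreal (d i powr s)) < ennreal e)"

lemma hausdorff_nullD:
  assumes "hausdorff_null s C" "0 < e"
  obtains x d where "\<And>i::nat. 0 \<le> d i" "C \<subseteq> (\<Union>i. cball (x i) (d i))"
    "(\<Sum>i. ennreal (d i powr s)) < ennreal e"
  using assms unfolding hausdorff_null_def by meson

lemma powr_lt_of_suminf_lt:
  fixes d :: "nat \<Rightarrow> real"
  assumes "(\<Sum>i. ennreal (d i powr s)) < ennreal e"
  shows "d i powr s < e"
proof -
  have "g i \<le> suminf g" for g :: "nat \<Rightarrow> ennreal"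
    using sum_le_suminf[of g "{i}"] by simp
  from this[of "\<lambda>i. ennreal (d i powr s)"]
  have "ennreal (d i powr s) < ennreal e" using assms by (rule le_less_trans)
  then show ?thesis by (simp add: ennreal_less_iff)
qed

text \<open>Covers in \<open>hausdorff_covers\<close> need positive diameters, so each radius
  \<open>d i\<close> is raised to at least some \<open>p i > 0\<close>, where the
  \<open>s\<close>-th powers of the \<open>p i\<close> form a small geometric series. In a Euclidean
  space a ball of radius \<open>D i\<close> has diameter exactly \<open>2 * D i\<close>.\<close>

lemma hausdorff_null_imp_measure_zero:
  fixes C :: "'a::euclidean_space set"
  assumes "hausdorff_null s C" "0 < s"
  shows "hausdorff_measure s C = 0"
proof -
  have "hausdorff_premeasure \<delta> s C \<le> ennreal e" if "0 < \<delta>" "0 < e" for \<delta> e :: real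
  proof -
    \<comment> \<open>The first bound forces every radius to be at most \<open>\<delta>/2\<close>.
      The second absorbs the factor \<open>2 powr s\<close> from doubling radii to diameters and the
      two sums, each at most \<open>e'\<close>.\<close>
    define e' where "e' = min ((\<delta>/2) powr s) (e / (2 * 2 powr s))"
    have e': "0 < e'" "e' \<le> (\<delta>/2) powr s" "2 powr s * (2 * e') \<le> e"
    proof -
      have "e' \<le> e / (2 * 2 powr s)" by (simp add: e'_def)
      then show "2 powr s * (2 * e') \<le> e" by (simp add: field_simps)
    qed (use that in \<open>auto simp: e'_def\<close>)
    obtain x d where xd: "\<And>i::nat. 0 \<le> d i" "C \<subseteq> (\<Union>i. cball (x i) (d i))"
      "(\<Sum>i. ennreal (d i powr s)) < ennreal e'"
      by (rule hausdorff_nullD[OF assms(1) e'(1)]) (rule that)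
    define p where "p = (\<lambda>i::nat. (e' * (1/2)^(Suc i)) powr (1/s))"
    have p: "0 < p i" "p i powr s = e' * (1/2)^(Suc i)" for i
      using e' assms by (auto simp: p_def powr_powr)
    define D where "D = (\<lambda>i. max (d i) (p i))"
    have D0: "0 < D i" for i using p by (auto simp: D_def less_max_iff_disj)
    have Ds: "D i powr s \<le> e'" for i
    proof -
      have "(1/2::real)^(Suc i) \<le> 1" by (rule power_le_one) auto
      then have "p i powr s \<le> e'" using e' p(2)[of i]
        by (metis mult.right_neutral mult_left_mono less_imp_le)
      moreover have "d i powr s \<le> e'" using powr_lt_of_suminf_lt[OF xd(3)] by (simp add: less_imp_le)
      ultimately show ?thesis by (auto simp: D_def max_def)
    qed
    have D\<delta>: "2 * D i \<le> \<delta>" for i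
    proof (rule ccontr)
      assume "\<not> ?thesis"
      then have "(\<delta>/2) powr s < D i powr s" using that assms by (intro powr_less_mono2) auto
      with Ds e'(2) show False by (meson leD order_trans)
    qed
    define U where "U = (\<lambda>i. cball (x i) (D i))"
    have dU: "diameter (U i) = 2 * D i" for i
      unfolding U_def using D0[of i] by simp
    have "C \<subseteq> (\<Union>i. U i)"
    proof
      fix y assume "y \<in> C"
      then obtain i where "y \<in> cball (x i) (d i)" using xd by blast
      then show "y \<in> (\<Union>i. U i)" by (auto simp: U_def D_def intro!: exI[of _ i])
    qed
    then have "U \<in> hausdorff_covers \<delta> C"
      unfolding hausdorff_covers_def using dU D0 D\<delta> by (auto simp: U_def)
    then have "hausdorff_premeasure \<delta> s C \<le> (\<Sum>i. ennreal (diameter (U i) powr s))"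
      unfolding hausdorff_premeasure_def by (rule INF_lower)
    also have "\<dots> \<le> (\<Sum>i. ennreal (2 powr s) * (ennreal (d i powr s) + ennreal (e' * (1/2)^(Suc i))))"
    proof (intro suminf_le allI)
      fix i
      have "D i powr s \<le> d i powr s + p i powr s" by (auto simp: D_def max_def)
      then have "diameter (U i) powr s \<le> 2 powr s * (d i powr s + e' * (1/2)^(Suc i))"
        using D0[of i] p(2)[of i] by (simp add: dU powr_mult)
      then show "ennreal (diameter (U i) powr s)
        \<le> ennreal (2 powr s) * (ennreal (d i powr s) + ennreal (e' * (1/2)^(Suc i)))"
        using e'(1) by (simp add: ennreal_mult'[symmetric] ennreal_plus[symmetric] ennreal_leI del: ennreal_plus)
    qed auto
    also have "\<dots> = ennreal (2 powr s) * ((\<Sum>i. ennreal (d i powr s)) + (\<Sum>i. ennreal (e' * (1/2)^(Suc i))))"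
      by (simp add: suminf_add)
    also have "(\<Sum>i. ennreal (e' * (1/2)^(Suc i))) = ennreal e'"
    proof (rule suminf_ennreal_eq)
      show "(\<lambda>i. e' * (1/2)^(Suc i)) sums e'"
        using sums_mult[OF power_half_series, of e'] by simp
    qed (use e' in auto)
    also have "ennreal (2 powr s) * ((\<Sum>i. ennreal (d i powr s)) + ennreal e')
        \<le> ennreal (2 powr s) * (ennreal e' + ennreal e')"
      using xd(3) by (intro mult_left_mono add_mono) auto
    also have "\<dots> = ennreal (2 powr s * (2 * e'))"
      using e'(1) by (simp add: ennreal_plus[symmetric] ennreal_mult'[symmetric] del: ennreal_plus)
    also have "\<dots> \<le> ennreal e" using e'(3) by (rule ennreal_leI)
    finally show ?thesis .
  qed
  then have "hausdorff_premeasure \<delta> s C = 0" if "0 < \<delta>" for \<delta>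
    using that ennreal_le_epsilon[of 0 "hausdorff_premeasure \<delta> s C"]
    by (metis add_0 le_zero_eq ennreal_le_epsilon)
  then show ?thesis unfolding hausdorff_measure_eq_SUP by simp
qed

text \<open>A cover at scale \<open>1\<close> suffices: a set lies in the ball around any of its
  points with its diameter as radius, and raising the exponent does not increase powers of diameters
  that are at most \<open>1\<close>.\<close>

lemma hausdorff_measure_zero_imp_null:
  fixes C :: "'a::metric_space set"
  assumes "hausdorff_measure s C = 0" "s \<le> t"
  shows "hausdorff_null t C"
  unfolding hausdorff_null_def
proof (intro allI impI)
  fix e :: real assume e: "0 < e"
  have "hausdorff_premeasure 1 s C \<le> (SUP \<delta>\<in>{0<..}. hausdorff_premeasure \<delta> s C)"
    by (rule SUP_upper) simp
  then have "hausdorff_premeasure 1 s C < ennreal e"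
    using assms(1) e by (simp add: hausdorff_measure_eq_SUP)
  then obtain U where U: "U \<in> hausdorff_covers 1 C" "(\<Sum>i. ennreal (diameter (U i) powr s)) < ennreal e"
    unfolding hausdorff_premeasure_def by (auto simp: INF_less_iff)
  have U': "C \<subseteq> (\<Union>i. U i)" "\<And>i. bounded (U i)" "\<And>i. 0 < diameter (U i)" "\<And>i. diameter (U i) \<le> 1"
    using U(1) by (auto simp: hausdorff_covers_def)
  have "U i \<noteq> {}" for i using U'(3)[of i] by auto
  then have "\<exists>x. \<forall>i. x i \<in> U i" by (intro choice) blast
  then obtain x where x: "\<And>i. x i \<in> U i" by blast
  have "U i \<subseteq> cball (x i) (diameter (U i))" for i
  proof
    fix y assume "y \<in> U i"
    then have "dist (x i) y \<le> diameter (U i)" by (rule diameter_bounded_bound[OF U'(2) x])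
    then show "y \<in> cball (x i) (diameter (U i))" by simp
  qed
  then have "C \<subseteq> (\<Union>i. cball (x i) (diameter (U i)))"
    by (intro order_trans[OF U'(1)] UN_mono) auto
  moreover have "(\<Sum>i. ennreal (diameter (U i) powr t)) \<le> (\<Sum>i. ennreal (diameter (U i) powr s))"
  proof (rule suminf_le)
    fix i
    show "ennreal (diameter (U i) powr t) \<le> ennreal (diameter (U i) powr s)"
      by (rule ennreal_leI, rule powr_mono'[OF assms(2) less_imp_le[OF U'(3)] U'(4)])
  qed auto
  ultimately show "\<exists>x d. (\<forall>i::nat. 0 \<le> d i) \<and> C \<subseteq> (\<Union>i. cball (x i) (d i)) \<and>
        (\<Sum>i. ennreal (d i powr t)) < ennreal e"
    using U(2) U'(3) le_less_trans by (intro exI[of _ x] exI[of _ "\<lambda>i. diameter (U i)"]) (simp add: less_imp_le)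
qed

lemma hausdorff_null_holder:
  fixes \<phi> :: "'b \<Rightarrow> 'a::metric_space" and \<theta> :: "'b \<Rightarrow> 'c::metric_space"
  assumes "hausdorff_null s (\<phi> ` T)" "0 \<le> K" "0 < s" "0 \<le> t" "s \<le> \<gamma> * t"
    and H: "\<And>A B. A \<in> T \<Longrightarrow> B \<in> T \<Longrightarrow> dist (\<theta> A) (\<theta> B) \<le> K * dist (\<phi> A) (\<phi> B) powr \<gamma>"
  shows "hausdorff_null t (\<theta> ` T)"
  unfolding hausdorff_null_def
proof (intro allI impI)
  fix e :: real assume e: "0 < e"
  have \<gamma>: "0 < \<gamma>" using assms by (smt (verit) mult_nonpos_nonneg)
  define c where "c = (K * 2 powr \<gamma>) powr t"
  \<comment> \<open>The cap \<open>1\<close> forces all radii to be at most \<open>1\<close>, so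
    that \<open>s \<le> \<gamma> * t\<close> can be used. Dividing by \<open>c + 1\<close> also
    covers \<open>c = 0\<close>.\<close>
  define e' where "e' = min 1 (e / (c + 1))"
  have c0: "0 \<le> c" by (simp add: c_def)
  then have e': "0 < e'" "e' \<le> 1" "c * e' < e"
  proof -
    have "c * e' \<le> c * (e / (c + 1))" using c0 by (intro mult_left_mono) (auto simp: e'_def)
    also have "\<dots> < e" using c0 e by (simp add: field_simps)
    finally show "c * e' < e" .
  qed (use c0 e in \<open>auto simp: e'_def\<close>)
  obtain x d where xd: "\<And>i::nat. 0 \<le> d i" "\<phi> ` T \<subseteq> (\<Union>i. cball (x i) (d i))"
    "(\<Sum>i. ennreal (d i powr s)) < ennreal e'"
    by (rule hausdorff_nullD[OF assms(1) e'(1)]) (rule that)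
  define a where "a = (\<lambda>i. SOME A. A \<in> T \<and> \<phi> A \<in> cball (x i) (d i))"
  define D where "D = (\<lambda>i. K * (2 * d i) powr \<gamma>)"
  have "\<theta> ` T \<subseteq> (\<Union>i. cball (\<theta> (a i)) (D i))"
  proof clarify
    fix A assume A: "A \<in> T"
    then obtain i where i: "\<phi> A \<in> cball (x i) (d i)" using xd(2) by blast
    have a: "a i \<in> T \<and> \<phi> (a i) \<in> cball (x i) (d i)"
      unfolding a_def by (rule someI[of _ A]) (use A i in auto)
    have "dist (\<phi> (a i)) (\<phi> A) \<le> 2 * d i"
      using i a dist_triangle3[of "\<phi> (a i)" "\<phi> A" "x i"] by auto
    then have "K * dist (\<phi> (a i)) (\<phi> A) powr \<gamma> \<le> D i"
      unfolding D_def using assms(2) \<gamma> by (intro mult_left_mono powr_mono2) auto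
    with H[of "a i" A] a A have "\<theta> A \<in> cball (\<theta> (a i)) (D i)" by simp
    then show "\<theta> A \<in> (\<Union>i. cball (\<theta> (a i)) (D i))" by blast
  qed
  moreover have "(\<Sum>i. ennreal (D i powr t)) < ennreal e"
  proof -
    have d1: "d i \<le> 1" for i
    proof (rule ccontr)
      assume "\<not> ?thesis"
      then have "1 < d i powr s" using assms(3) by (simp add: gr_one_powr)
      with powr_lt_of_suminf_lt[OF xd(3), of i] e'(2) show False by linarith
    qed
    have "(\<Sum>i. ennreal (D i powr t)) \<le> (\<Sum>i. ennreal c * ennreal (d i powr s))"
    proof (intro suminf_le allI)
      fix i
      have "D i powr t = c * d i powr (\<gamma> * t)"
        using xd(1)[of i] assms(2) by (simp add: D_def c_def powr_mult powr_powr)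
      also have "\<dots> \<le> c * d i powr s"
        using d1 xd(1) c0 assms(5) by (intro mult_left_mono powr_mono') auto
      finally show "ennreal (D i powr t) \<le> ennreal c * ennreal (d i powr s)"
        using c0 by (simp add: ennreal_mult'[symmetric] ennreal_leI)
    qed auto
    also have "\<dots> = ennreal c * (\<Sum>i. ennreal (d i powr s))" by simp
    also have "\<dots> \<le> ennreal c * ennreal e'" using xd(3) by (intro mult_left_mono) auto
    also have "\<dots> < ennreal e" using c0 e' by (simp add: ennreal_mult'[symmetric] ennreal_lessI e)
    finally show ?thesis .
  qed
  ultimately show "\<exists>x d. (\<forall>i::nat. 0 \<le> d i) \<and> \<theta> ` T \<subseteq> (\<Union>i. cball (x i) (d i)) \<and>
        (\<Sum>i. ennreal (d i powr t)) < ennreal e"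
    using assms(2) by (intro exI[of _ "\<lambda>i. \<theta> (a i)"] exI[of _ D]) (auto simp: D_def)
qed

lemma hausdorff_null_mono:
  assumes "hausdorff_null s C" "0 < s" "s \<le> t"
  shows "hausdorff_null t C"
  using hausdorff_null_holder[of s "\<lambda>x. x" C 1 t 1 "\<lambda>x. x"] assms by simp

lemma hausdorff_null_subset: "hausdorff_null s C \<Longrightarrow> B \<subseteq> C \<Longrightarrow> hausdorff_null s B"
  unfolding hausdorff_null_def by (meson subset_trans)

lemma hausdorff_null_finite_covers:
  assumes s: "0 < s"
    and cov: "\<And>e. 0 < e \<Longrightarrow> \<exists>P \<rho>. finite P \<and> 0 \<le> \<rho> \<and> C \<subseteq> (\<Union>p\<in>P. cball p \<rho>) \<and> card P * \<rho> powr s < e"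
  shows "hausdorff_null s C"
  unfolding hausdorff_null_def
proof (intro allI impI)
  fix e :: real assume "0 < e"
  from cov[OF this] obtain P \<rho> where P: "finite P" "0 \<le> \<rho>" "C \<subseteq> (\<Union>p\<in>P. cball p \<rho>)"
    "card P * \<rho> powr s < e" by blast
  show "\<exists>x d. (\<forall>i::nat. 0 \<le> d i) \<and> C \<subseteq> (\<Union>i. cball (x i) (d i)) \<and>
        (\<Sum>i. ennreal (d i powr s)) < ennreal e"
  proof -
    obtain x where x: "bij_betw x {0..<card P} P" using P(1) ex_bij_betw_nat_finite by blast
    define d where "d = (\<lambda>i. if i < card P then \<rho> else 0)"
    have "C \<subseteq> (\<Union>i. cball (x i) (d i))"
    proof
      fix y assume "y \<in> C"
      then obtain p where "p \<in> P" "y \<in> cball p \<rho>" using P by blast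
      moreover have "p \<in> x ` {0..<card P}" using x \<open>p \<in> P\<close> by (simp add: bij_betw_def)
      then obtain i where "i < card P" "x i = p" by auto
      ultimately have "y \<in> cball (x i) (d i)" by (simp add: d_def)
      then show "y \<in> (\<Union>i. cball (x i) (d i))" by blast
    qed
    moreover have "(\<Sum>i. ennreal (d i powr s)) = (\<Sum>i<card P. ennreal (\<rho> powr s))"
      by (subst suminf_finite[of "{..<card P}"]) (auto simp: d_def)
    moreover have "\<dots> = ennreal (card P * \<rho> powr s)"
      by (simp add: ennreal_mult' ennreal_of_nat_eq_real_of_nat)
    ultimately show ?thesis using P(2,4) \<open>0 < e\<close>
      by (intro exI[of _ x] exI[of _ d]) (auto simp: d_def ennreal_lessI)
  qed
qed

text \<open>The volume of a ball is a constant times the \<open>DIM('a)\<close>-th power of its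
  radius, so countable subadditivity turns the small sum into a small outer measure. This is the
  source of all lower bounds on dimension below.\<close>

lemma hausdorff_null_imp_negligible:
  fixes C :: "'a::euclidean_space set"
  assumes "hausdorff_null (real DIM('a)) C"
  shows "negligible C"
  unfolding negligible_outer_le
proof (intro allI impI)
  fix e :: real assume e: "0 < e"
  define c where "c = unit_ball_vol (real DIM('a))"
  have c: "0 < c" by (simp add: c_def)
  obtain x d where xd: "\<And>i::nat. 0 \<le> d i" "C \<subseteq> (\<Union>i. cball (x i) (d i))"
    "(\<Sum>i. ennreal (d i powr (real DIM('a)))) < ennreal (e / c)"
    by (rule hausdorff_nullD[OF assms divide_pos_pos[OF e c]]) (rule that)
  let ?T = "\<Union>i. cball (x i) (d i)"
  have "emeasure lborel ?T \<le> (\<Sum>i. emeasure lborel (cball (x i) (d i)))"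
    by (rule emeasure_subadditive_countably) auto
  also have "\<dots> = (\<Sum>i. ennreal c * ennreal (d i powr real DIM('a)))"
    using xd(1) by (simp add: emeasure_cball c_def powr_realpow' ennreal_mult')
  also have "\<dots> = ennreal c * (\<Sum>i. ennreal (d i powr (real DIM('a))))" by simp
  also have "\<dots> \<le> ennreal c * ennreal (e / c)" using xd(3) by (intro mult_left_mono) auto
  also have "\<dots> = ennreal e" using c by (simp add: ennreal_mult'[symmetric])
  finally have *: "emeasure lborel ?T \<le> ennreal e" .
  then have "emeasure lebesgue ?T \<le> ennreal e" by (simp add: emeasure_completion)
  moreover have "?T \<in> sets lebesgue" by (intro sets.countable_UN) auto
  ultimately have "?T \<in> lmeasurable" "measure lebesgue ?T \<le> e"
    using e by (auto simp: fmeasurable_def measure_def enn2real_leI intro: le_less_trans)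
  with xd(2) show "\<exists>T. C \<subseteq> T \<and> T \<in> lmeasurable \<and> measure lebesgue T \<le> e" by blast
qed

lemma dim_H_eqI:
  fixes C :: "'a::euclidean_space set"
  assumes r: "0 < r" and up: "\<And>s. r < s \<Longrightarrow> hausdorff_null s C"
    and lo: "\<And>s. 0 < s \<Longrightarrow> s < r \<Longrightarrow> \<not> hausdorff_null s C"
  shows "dim_H C = ereal r"
  unfolding dim_H_def
proof (rule antisym)
  show "(INF s\<in>{s. 0 \<le> s \<and> hausdorff_measure s C = 0}. ereal s) \<le> ereal r"
  proof (rule ereal_le_epsilon2)
    fix e :: real assume "0 < e"
    then have "hausdorff_measure (r + e) C = 0"
      by (intro hausdorff_null_imp_measure_zero up) (use r in auto)
    then show "(INF s\<in>{s. 0 \<le> s \<and> hausdorff_measure s C = 0}. ereal s) \<le> ereal r + ereal e"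
      using \<open>0 < e\<close> r by (intro INF_lower2[of "r + e"]) auto
  qed
  show "ereal r \<le> (INF s\<in>{s. 0 \<le> s \<and> hausdorff_measure s C = 0}. ereal s)"
  proof (rule INF_greatest, clarify)
    fix s assume s: "0 \<le> s" "hausdorff_measure s C = 0"
    show "ereal r \<le> ereal s"
    proof (rule ccontr)
      assume "\<not> ?thesis"
      then have "s < r" by simp
      \<comment> \<open>The midpoint of \<open>s\<close> and \<open>r\<close> is positive even when
        \<open>s = 0\<close>, as \<open>lo\<close> requires.\<close>
      then show False
        using hausdorff_measure_zero_imp_null[OF s(2), of "(s + r) / 2"] lo[of "(s + r) / 2"] s r by simp
    qed
  qed
qed

section \<open>Sets of dimension zero\<close>

text \<open>Every interval contains points outside \<open>A\<close>. A box whose faces have such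
  coordinates cuts the same subset out of \<open>F\<close> as its closure does, so this subset is
  clopen in \<open>F\<close> and has empty frontier.\<close>

lemma dim_ind_le_0:
  fixes F :: "(real ^ 'n) set"
  assumes F: "F \<subseteq> {x. \<forall>i. x $ i \<in> A}" and A: "interior A = {}"
  shows "dim_ind F \<le> 0"
proof -
  have ex: "\<exists>p. a < p \<and> p < b \<and> p \<notin> A" if "a < b" for a b :: real
  proof (rule ccontr)
    assume "\<not> ?thesis"
    then have "{a<..<b} \<subseteq> interior A" by (intro interior_maximal) auto
    with A that show False using dense by fastforce
  qed
  have "top_of_set F dim_le 0"
  proof (rule dimension_le.intros)
    fix V a assume V: "openin (top_of_set F) V" "a \<in> V"
    then obtain e where e: "0 < e" "ball a e \<inter> F \<subseteq> V" "a \<in> F"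
      by (metis openin_contains_ball subsetD)
    \<comment> \<open>The norm is at most the sum of the \<open>CARD('n)\<close> coordinate
      distances, hence at most \<open>e / 2\<close>.\<close>
    define \<delta> where "\<delta> = e / (2 * real CARD('n))"
    have \<delta>: "0 < \<delta>" using e by (simp add: \<delta>_def)
    have "\<exists>p. \<forall>i. a $ i - \<delta> < p i \<and> p i < a $ i \<and> p i \<notin> A"
      using \<delta> by (intro choice allI ex) simp
    then obtain p where p: "\<And>i. a $ i - \<delta> < p i" "\<And>i. p i < a $ i" "\<And>i. p i \<notin> A" by blast
    have "\<exists>q. \<forall>i. a $ i < q i \<and> q i < a $ i + \<delta> \<and> q i \<notin> A"
      using \<delta> by (intro choice allI ex) simp
    then obtain q where q: "\<And>i. a $ i < q i" "\<And>i. q i < a $ i + \<delta>" "\<And>i. q i \<notin> A" by blast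
    let ?U = "F \<inter> box (\<chi> i. p i) (\<chi> i. q i)"
    have "a \<in> ?U" using e p q by (auto simp: mem_box_cart)
    have "?U \<subseteq> ball a e"
    proof
      fix x assume x: "x \<in> ?U"
      have "norm (a - x) \<le> (\<Sum>i\<in>UNIV. \<bar>(a - x) $ i\<bar>)" by (rule norm_le_l1_cart)
      also have "\<dots> \<le> (\<Sum>i\<in>(UNIV::'n set). \<delta>)"
      proof (rule sum_mono)
        fix i show "\<bar>(a - x) $ i\<bar> \<le> \<delta>" using x p(1)[of i] q(2)[of i] by (auto simp: mem_box_cart abs_le_iff) (smt (verit))+
      qed
      also have "\<dots> < e" using e by (simp add: \<delta>_def)
      finally show "x \<in> ball a e" by (simp add: dist_norm)
    qed
    then have "?U \<subseteq> V" using e by blast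
    have "openin (top_of_set F) ?U" by (auto intro: openin_open_Int)
    have "?U = F \<inter> cbox (\<chi> i. p i) (\<chi> i. q i)"
    proof -
      have *: "p i < x $ i \<and> x $ i < q i" if "x \<in> F" "p i \<le> x $ i \<and> x $ i \<le> q i" for x i
        using that F p(3)[of i] q(3)[of i] by (metis (mono_tags) mem_Collect_eq order_le_less subsetD)
      show ?thesis
      proof (intro subset_antisym Int_greatest)
        show "F \<inter> box (\<chi> i. p i) (\<chi> i. q i) \<subseteq> cbox (\<chi> i. p i) (\<chi> i. q i)"
          using box_subset_cbox by blast
        show "F \<inter> cbox (\<chi> i. p i) (\<chi> i. q i) \<subseteq> box (\<chi> i. p i) (\<chi> i. q i)"
          using * by (simp add: subset_iff mem_box_cart)
      qed auto
    qed
    then have "closedin (top_of_set F) ?U" by (auto intro: closedin_closed_Int)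
    then have "(top_of_set F) frontier_of ?U = {}"
      by (metis \<open>openin (top_of_set F) ?U\<close> clopenin_eq_frontier_of)
    then show "\<exists>U. a \<in> U \<and> U \<subseteq> V \<and> openin (top_of_set F) U \<and>
        subtopology (top_of_set F) ((top_of_set F) frontier_of U) dim_le 0 - 1"
      using \<open>a \<in> ?U\<close> \<open>?U \<subseteq> V\<close> \<open>openin (top_of_set F) ?U\<close>
      by (intro exI[of _ ?U] conjI) simp_all
  qed simp
  then have "dim_ind F \<le> ereal (of_int 0)"
    unfolding dim_ind_def by (intro INF_lower) simp
  then show ?thesis by (simp add: zero_ereal_def)
qed

section \<open>Subset sums\<close>

definition subset_sum :: "(nat \<Rightarrow> real) \<Rightarrow> nat set \<Rightarrow> real" where
  "subset_sum c S = (\<Sum>k. c k * indicator S k)"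

lemma summable_subset_sum:
  fixes c :: "nat \<Rightarrow> real"
  assumes "summable c" "\<And>k. 0 \<le> c k"
  shows "summable (\<lambda>k. c k * indicator S k)"
  by (rule summable_comparison_test'[OF assms(1), of 0]) (use assms in \<open>auto simp: indicator_def\<close>)

lemma subset_sum_bounds:
  assumes "summable c" "\<And>k. 0 \<le> c k"
  shows "0 \<le> subset_sum c S" "subset_sum c S \<le> suminf c"
  unfolding subset_sum_def
  by (intro suminf_nonneg suminf_le summable_subset_sum assms; use assms in \<open>simp add: indicator_def\<close>)+

text \<open>The termwise differences vanish before \<open>k\<close> and are bounded by
  \<open>c\<close> from \<open>k\<close> on.\<close>

lemma subset_sum_diff_le_tail:
  assumes c: "summable c" "\<And>k. 0 \<le> c k"
    and agree: "\<And>j. j < k \<Longrightarrow> j \<in> S \<longleftrightarrow> j \<in> S'"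
  shows "\<bar>subset_sum c S - subset_sum c S'\<bar> \<le> (\<Sum>j. c (j + k))"
proof -
  define h where "h = (\<lambda>j. c j * indicator S j - c j * indicator S' j)"
  have sh: "summable h" unfolding h_def by (intro summable_diff summable_subset_sum c)
  have "subset_sum c S - subset_sum c S' = suminf h"
    unfolding subset_sum_def h_def by (intro suminf_diff summable_subset_sum c)
  also have "\<dots> = (\<Sum>j. h (j + k)) + (\<Sum>j<k. h j)"
    by (rule suminf_split_initial_segment[OF sh])
  also have "(\<Sum>j<k. h j) = 0" using agree by (intro sum.neutral) (auto simp: h_def indicator_def)
  finally have "\<bar>subset_sum c S - subset_sum c S'\<bar> = \<bar>\<Sum>j. h (j + k)\<bar>" by simp
  also have "\<dots> \<le> (\<Sum>j. c (j + k))"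
  proof -
    have le: "norm (h (j + k)) \<le> c (j + k)" for j using c(2)[of "j + k"] by (auto simp: h_def indicator_def)
    have sc: "summable (\<lambda>j. c (j + k))" using c(1) by (rule summable_ignore_initial_segment)
    have "norm (\<Sum>j. h (j + k)) \<le> (\<Sum>j. c (j + k))" by (rule norm_suminf_le[OF le sc])
    then show ?thesis by simp
  qed
  finally show ?thesis .
qed

text \<open>If \<open>k\<close> lies in \<open>S\<close> only, inserting it into \<open>S'\<close>
  adds exactly \<open>c k\<close> and makes the two sets agree through position \<open>k\<close>;
  the tail bound from \<open>Suc k\<close> limits what later digits can undo.\<close>

lemma subset_sum_diff_ge_gap:
  assumes c: "summable c" "\<And>k. 0 \<le> c k"
    and agree: "\<And>j. j < k \<Longrightarrow> j \<in> S \<longleftrightarrow> j \<in> S'" and k: "(k \<in> S) \<noteq> (k \<in> S')"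
  shows "c k - (\<Sum>j. c (j + Suc k)) \<le> \<bar>subset_sum c S - subset_sum c S'\<bar>"
proof -
  have *: "c k - (\<Sum>j. c (j + Suc k)) \<le> \<bar>subset_sum c S - subset_sum c S'\<bar>"
    if a: "\<And>j. j < k \<Longrightarrow> j \<in> S \<longleftrightarrow> j \<in> S'" and kS: "k \<in> S" "k \<notin> S'" for S S'
  proof -
    have "subset_sum c (insert k S') = (\<Sum>j. c j * indicator S' j + c j * indicator {k} j)"
      unfolding subset_sum_def using kS by (intro suminf_cong) (auto simp: indicator_def)
    also have "\<dots> = subset_sum c S' + (\<Sum>j. c j * indicator {k} j)"
      unfolding subset_sum_def by (intro suminf_add[symmetric] summable_subset_sum c)
    also have "(\<Sum>j. c j * indicator {k} j) = c k"
      by (subst suminf_finite[of "{k}"]) auto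
    finally have 1: "subset_sum c (insert k S') = subset_sum c S' + c k" .
    have "\<bar>subset_sum c S - subset_sum c (insert k S')\<bar> \<le> (\<Sum>j. c (j + Suc k))"
      by (rule subset_sum_diff_le_tail[OF c]) (use a kS in \<open>auto simp: less_Suc_eq\<close>)
    with 1 show ?thesis by linarith
  qed
  show ?thesis
  proof (cases "k \<in> S")
    case True
    with k show ?thesis by (intro *) (use agree in auto)
  next
    case False
    with k have "c k - (\<Sum>j. c (j + Suc k)) \<le> \<bar>subset_sum c S' - subset_sum c S\<bar>"
      by (intro *) (use agree in auto)
    then show ?thesis by (simp add: abs_minus_commute)
  qed
qed

section \<open>Cantor weights and binary weights\<close>

text \<open>For \<open>\<beta> = 1\<close> the powers of two alone would leave no gap between a
  weight and the sum of its successors. The denominator opens a gap at polynomial cost, which keeps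
  every Hoelder exponent below \<open>1 / \<beta>\<close>, and it also makes the covering sums at
  the critical exponent tend to \<open>0\<close>.\<close>

definition cantor_weight :: "real \<Rightarrow> nat \<Rightarrow> real" where
  "cantor_weight \<beta> k = 2 powr (- \<beta> * real k) / (real k + 1)"

definition binary_weight :: "nat \<Rightarrow> real" where
  "binary_weight k = (1/2) ^ Suc k"

lemma binary_weight: "0 \<le> binary_weight k" "summable binary_weight"
  "(\<Sum>j. binary_weight (j + k)) = (1/2) ^ k"
proof -
  show "0 \<le> binary_weight k" by (simp add: binary_weight_def)
  have "(\<lambda>j. (1/2::real) ^ Suc j) sums 1" by (rule power_half_series)
  then show "summable binary_weight" unfolding binary_weight_def by (rule sums_summable)
  have "(\<lambda>j. (1/2)^k * (1/2::real) ^ Suc j) sums ((1/2)^k * 1)"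
    by (intro sums_mult power_half_series)
  then show "(\<Sum>j. binary_weight (j + k)) = (1/2) ^ k"
    unfolding binary_weight_def by (intro sums_unique[symmetric]) (simp add: power_add mult_ac)
qed

lemma two_powr_minus: "2 powr (- real k) = (1/2) ^ k"
  unfolding powr_minus powr_realpow[OF zero_less_numeral] power_one_over by (rule inverse_eq_divide)

lemma cantor_weight_pos: "0 < cantor_weight \<beta> k"
  by (simp add: cantor_weight_def add_nonneg_pos)

text \<open>Since \<open>\<beta> \<ge> 1\<close>, the powers decay at least as fast as those of
  \<open>1/2\<close>, and all later denominators are at least \<open>k + 2\<close>.\<close>

lemma cantor_weight_shift_le:
  assumes "1 \<le> \<beta>"
  shows "cantor_weight \<beta> (j + Suc k) \<le> 2 powr (- \<beta> * real k) / (real k + 2) * (1/2) ^ Suc j"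
proof -
  have "2 powr (- \<beta> * real (j + Suc k)) = 2 powr (- \<beta> * real k) * 2 powr (- \<beta> * real (Suc j))"
    by (simp add: powr_add[symmetric] algebra_simps)
  also have "2 powr (- \<beta> * real (Suc j)) \<le> 2 powr (- real (Suc j))"
    proof (rule powr_mono)
    show "- \<beta> * real (Suc j) \<le> - real (Suc j)"
      using mult_right_mono[OF assms, of "real (Suc j)"] by (simp del: of_nat_Suc)
  qed simp
  also have "2 powr (- real (Suc j)) = (1/2::real) ^ Suc j" by (rule two_powr_minus)
  finally have "2 powr (- \<beta> * real (j + Suc k)) \<le> 2 powr (- \<beta> * real k) * (1/2) ^ Suc j" by simp
  then have "cantor_weight \<beta> (j + Suc k) \<le> (2 powr (- \<beta> * real k) * (1/2) ^ Suc j) / (real k + 2)"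
    unfolding cantor_weight_def by (intro frac_le) auto
  then show ?thesis by (simp only: times_divide_eq_left)
qed

lemma cantor_weight_summable:
  assumes "1 \<le> \<beta>"
  shows "summable (cantor_weight \<beta>)"
proof -
  have "summable (\<lambda>j. cantor_weight \<beta> (j + Suc 0))"
  proof (rule summable_comparison_test')
    show "summable (\<lambda>j. (1/2) * (1/2::real) ^ Suc j)"
      by (intro summable_mult sums_summable[OF power_half_series])
    show "norm (cantor_weight \<beta> (j + Suc 0)) \<le> (1/2) * (1/2) ^ Suc j" if "0 \<le> j" for j
      using cantor_weight_shift_le[OF assms, of j 0] cantor_weight_pos[of \<beta> "j + Suc 0"] by simp
  qed
  then show ?thesis by (simp add: summable_iff_shift del: add_Suc_right)
qed

lemma cantor_weight_tail_le:
  assumes "1 \<le> \<beta>"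
  shows "(\<Sum>j. cantor_weight \<beta> (j + Suc k)) \<le> 2 powr (- \<beta> * real k) / (real k + 2)"
proof -
  have "(\<Sum>j. cantor_weight \<beta> (j + Suc k)) \<le> (\<Sum>j. 2 powr (- \<beta> * real k) / (real k + 2) * (1/2) ^ Suc j)"
    by (intro suminf_le cantor_weight_shift_le assms summable_ignore_initial_segment
        cantor_weight_summable summable_mult sums_summable[OF power_half_series])
  also have "\<dots> = 2 powr (- \<beta> * real k) / (real k + 2) * 1"
    by (intro sums_unique[symmetric] sums_mult power_half_series)
  finally show ?thesis by simp
qed

text \<open>The bound is the difference of \<open>1 / (k + 1)\<close> from the weight and
  \<open>1 / (k + 2)\<close> from the tail, times the common power of two.\<close>

lemma cantor_weight_gap_ge:
  assumes "1 \<le> \<beta>"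
  shows "2 powr (- \<beta> * real k) / ((real k + 1) * (real k + 2))
    \<le> cantor_weight \<beta> k - (\<Sum>j. cantor_weight \<beta> (j + Suc k))"
proof -
  have "2 powr (- \<beta> * real k) / ((real k + 1) * (real k + 2))
    = 2 powr (- \<beta> * real k) / (real k + 1) - 2 powr (- \<beta> * real k) / (real k + 2)"
    by (simp add: divide_simps) (simp add: algebra_simps)
  then show ?thesis using cantor_weight_tail_le[OF assms, of k] by (simp add: cantor_weight_def)
qed

lemma cantor_gap_pos: "0 < 2 powr (- \<beta> * real k) / ((real k + 1) * (real k + 2))"
  by (simp add: add_nonneg_pos)

text \<open>Here \<open>k\<close> is the first position where the digits differ. It is returned with
  the bound because the same \<open>k\<close> controls the binary sums.\<close>

lemma subset_sum_cantor_diff_ge: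
  assumes "1 \<le> \<beta>" "S \<noteq> S'"
  obtains k where "\<And>j. j < k \<Longrightarrow> j \<in> S \<longleftrightarrow> j \<in> S'" "(k \<in> S) \<noteq> (k \<in> S')"
    "2 powr (- \<beta> * real k) / ((real k + 1) * (real k + 2))
      \<le> \<bar>subset_sum (cantor_weight \<beta>) S - subset_sum (cantor_weight \<beta>) S'\<bar>"
proof -
  define k where "k = (LEAST k. (k \<in> S) \<noteq> (k \<in> S'))"
  have "\<exists>k. (k \<in> S) \<noteq> (k \<in> S')" using assms(2) by blast
  then have k: "(k \<in> S) \<noteq> (k \<in> S')" unfolding k_def by (rule LeastI_ex)
  have a: "j \<in> S \<longleftrightarrow> j \<in> S'" if "j < k" for j using not_less_Least[OF that[unfolded k_def]] by blast
  show thesis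
    using cantor_weight_gap_ge[OF assms(1), of k]
      subset_sum_diff_ge_gap[OF cantor_weight_summable[OF assms(1)] less_imp_le[OF cantor_weight_pos] a k]
    by (intro that[OF a k]) auto
qed

lemma inj_subset_sum_cantor:
  assumes "1 \<le> \<beta>"
  shows "inj (subset_sum (cantor_weight \<beta>))"
proof (rule injI, rule ccontr)
  fix S S' assume eq: "subset_sum (cantor_weight \<beta>) S = subset_sum (cantor_weight \<beta>) S'" and "S \<noteq> S'"
  from subset_sum_cantor_diff_ge[OF assms this(2)] obtain k where
    "2 powr (- \<beta> * real k) / ((real k + 1) * (real k + 2))
      \<le> \<bar>subset_sum (cantor_weight \<beta>) S - subset_sum (cantor_weight \<beta>) S'\<bar>" by metis
  with eq cantor_gap_pos[of \<beta> k] show False by linarith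
qed

text \<open>If the digits first differ at \<open>k\<close>, the binary sums differ by at most
  \<open>(1/2) ^ k\<close> and the Cantor sums by at least \<open>g k\<close>. The quotient
  \<open>q k\<close> of \<open>(1/2) ^ k\<close> by \<open>g k powr \<gamma>\<close> is exponential
  decay times a polynomially growing factor, as \<open>\<beta> * \<gamma> < 1\<close>, so it is
  bounded.\<close>

lemma binary_holder_cantor:
  assumes \<beta>: "1 \<le> \<beta>" and \<gamma>: "0 < \<gamma>" "\<beta> * \<gamma> < 1"
  obtains K where "0 \<le> K"
    "\<And>S S'. \<bar>subset_sum binary_weight S - subset_sum binary_weight S'\<bar>
       \<le> K * \<bar>subset_sum (cantor_weight \<beta>) S - subset_sum (cantor_weight \<beta>) S'\<bar> powr \<gamma>"
proof -
  define g where "g = (\<lambda>k::nat. 2 powr (- \<beta> * real k) / ((real k + 1) * (real k + 2)))"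
  have g0: "0 < g k" for k unfolding g_def by (rule cantor_gap_pos)
  define q where "q = (\<lambda>k::nat. 2 powr (- (1 - \<beta> * \<gamma>) * real k) * ((real k + 1) * (real k + 2)) powr \<gamma>)"
  \<comment> \<open>A name for the decay rate gives \<open>real_asymp\<close> an explicit sign
    assumption.\<close>
  define p where "p = 1 - \<beta> * \<gamma>"
  have "0 < p" using \<gamma> by (simp add: p_def)
  have "q \<longlonglongrightarrow> 0" unfolding q_def p_def[symmetric] using \<open>0 < p\<close> \<gamma>(1) by real_asymp
  then have "Bseq q" by (intro convergent_imp_Bseq convergentI)
  then obtain K where K: "0 < K" "\<And>k. \<bar>q k\<bar> \<le> K" unfolding Bseq_def by auto
  have qg: "(1/2) ^ k = q k * g k powr \<gamma>" for k
  proof -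
    have "g k powr \<gamma> = 2 powr (- \<beta> * \<gamma> * real k) / ((real k + 1) * (real k + 2)) powr \<gamma>"
      by (simp add: g_def powr_divide powr_powr mult_ac)
    then have "q k * g k powr \<gamma> = 2 powr (- (1 - \<beta> * \<gamma>) * real k) * 2 powr (- \<beta> * \<gamma> * real k)"
      by (simp add: q_def add_nonneg_eq_0_iff)
    also have "\<dots> = 2 powr (- real k)" by (simp add: powr_add[symmetric] algebra_simps)
    also have "\<dots> = (1/2) ^ k" by (rule two_powr_minus)
    finally show ?thesis by simp
  qed
  show thesis
  proof (rule that[of K])
    fix S S' :: "nat set"
    let ?d = "\<bar>subset_sum (cantor_weight \<beta>) S - subset_sum (cantor_weight \<beta>) S'\<bar>"
    show "\<bar>subset_sum binary_weight S - subset_sum binary_weight S'\<bar> \<le> K * ?d powr \<gamma>"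
    proof (cases "S = S'")
      case False
      from subset_sum_cantor_diff_ge[OF \<beta> this] obtain k where
        a: "\<And>j. j < k \<Longrightarrow> j \<in> S \<longleftrightarrow> j \<in> S'" and gd: "g k \<le> ?d" unfolding g_def by metis
      have "\<bar>subset_sum binary_weight S - subset_sum binary_weight S'\<bar> \<le> (1/2) ^ k"
        using subset_sum_diff_le_tail[OF binary_weight(2) binary_weight(1) a] by (simp add: binary_weight(3))
      also have "\<dots> \<le> K * g k powr \<gamma>"
        unfolding qg using K(2)[of k] by (intro mult_right_mono) auto
      also have "\<dots> \<le> K * ?d powr \<gamma>"
        using gd g0[of k] K(1) \<gamma> by (intro mult_left_mono powr_mono2) auto
      finally show ?thesis .
    qed (use K in auto)
  qed (use K in auto)
qed

text \<open>Position \<open>k\<close> carries the weight \<open>(1/2) ^ Suc k\<close>, so its digit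
  is the parity of the floor after scaling by \<open>2 ^ Suc k\<close>. The partial sums are then
  the dyadic lower approximations of \<open>x\<close>, starting from \<open>0\<close> because
  \<open>x < 1\<close>.\<close>

lemma binary_expansion:
  assumes x: "0 \<le> x" "x < 1"
  shows "subset_sum binary_weight {k. odd \<lfloor>x * 2 ^ Suc k\<rfloor>} = x"
proof -
  let ?S = "{k. odd \<lfloor>x * 2 ^ Suc k\<rfloor>}"
  have fl: "\<lfloor>2 * y\<rfloor> = 2 * \<lfloor>y\<rfloor> + (if odd \<lfloor>2 * y\<rfloor> then 1 else 0)" for y :: real
  proof -
    have "\<lfloor>2 * y\<rfloor> = 2 * \<lfloor>y\<rfloor> \<or> \<lfloor>2 * y\<rfloor> = 2 * \<lfloor>y\<rfloor> + 1" by linarith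
    then show ?thesis by auto
  qed
  have part: "(\<Sum>k<m. binary_weight k * indicator ?S k) = \<lfloor>x * 2 ^ m\<rfloor> / 2 ^ m" for m
  proof (induction m)
    case 0
    have "\<lfloor>x\<rfloor> = 0" using x by linarith
    then show ?case by simp
  next
    case (Suc m)
    have *: "real_of_int \<lfloor>x * 2 ^ Suc m\<rfloor> = 2 * real_of_int \<lfloor>x * 2 ^ m\<rfloor> + indicator ?S m"
      using arg_cong[OF fl[of "x * 2 ^ m"], of real_of_int] by (simp add: indicator_def mult_ac)
    have "(\<Sum>k<Suc m. binary_weight k * indicator ?S k)
        = \<lfloor>x * 2 ^ m\<rfloor> / 2 ^ m + indicator ?S m / 2 ^ Suc m"
      using Suc.IH by (simp add: binary_weight_def power_one_over)
    also have "\<dots> = \<lfloor>x * 2 ^ Suc m\<rfloor> / 2 ^ Suc m"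
      unfolding * by (simp add: field_simps)
    finally show ?case .
  qed
  have "(\<lambda>m. \<lfloor>x * 2 ^ m\<rfloor> / 2 ^ m) \<longlonglongrightarrow> x"
  proof (rule LIMSEQ_I)
    fix e :: real assume "0 < e"
    then obtain N where N: "(1/2::real) ^ N < e" using real_arch_pow_inv[of e "1/2"] by auto
    show "\<exists>N. \<forall>m\<ge>N. norm (\<lfloor>x * 2 ^ m\<rfloor> / 2 ^ m - x) < e"
    proof (intro exI allI impI)
      fix m assume "N \<le> m"
      have "\<lfloor>x * 2 ^ m\<rfloor> \<le> x * 2 ^ m" "x * 2 ^ m < \<lfloor>x * 2 ^ m\<rfloor> + 1" by linarith+
      then have "\<lfloor>x * 2 ^ m\<rfloor> / 2 ^ m \<le> x" "x < (\<lfloor>x * 2 ^ m\<rfloor> + 1) / 2 ^ m"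
        by (simp_all add: pos_divide_le_eq pos_less_divide_eq)
      then have "norm (\<lfloor>x * 2 ^ m\<rfloor> / 2 ^ m - x) \<le> (1/2) ^ m"
        by (simp add: add_divide_distrib power_one_over abs_le_iff)
      also have "\<dots> \<le> (1/2) ^ N" using \<open>N \<le> m\<close> by (intro power_decreasing) auto
      finally show "norm (\<lfloor>x * 2 ^ m\<rfloor> / 2 ^ m - x) < e" using N by simp
    qed
  qed
  then have "(\<lambda>k. binary_weight k * indicator ?S k) sums x"
    unfolding sums_def part .
  then show ?thesis unfolding subset_sum_def by (rule sums_unique[symmetric])
qed

section \<open>Points of the n-space given by digits\<close>

text \<open>A pair \<open>(i, k)\<close> marks a digit \<open>1\<close> at position \<open>k\<close>
  of coordinate \<open>i\<close>. With one set of pairs, truncation is an intersection and truncated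
  points are counted by a power set.\<close>

definition digit_point :: "(nat \<Rightarrow> real) \<Rightarrow> ('n \<times> nat) set \<Rightarrow> real ^ 'n" where
  "digit_point c A = (\<chi> i. subset_sum c {k. (i, k) \<in> A})"

lemma digit_point_nth [simp]: "digit_point c A $ i = subset_sum c {k. (i, k) \<in> A}"
  by (simp add: digit_point_def)

lemma dist_le_sum_components: "dist x y \<le> (\<Sum>i\<in>UNIV. \<bar>x $ i - y $ i\<bar>)" for x y :: "real ^ 'n"
  using norm_le_l1_cart[of "x - y"] by (simp add: dist_norm)

lemma inj_digit_point_cantor:
  assumes "1 \<le> \<beta>"
  shows "inj (digit_point (cantor_weight \<beta>) :: _ \<Rightarrow> real ^ 'n)"
proof (rule injI)
  fix A B :: "('n::finite \<times> nat) set"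
  assume "(digit_point (cantor_weight \<beta>) A :: real ^ 'n) = digit_point (cantor_weight \<beta>) B"
  then have "subset_sum (cantor_weight \<beta>) {k. (i, k) \<in> A} = subset_sum (cantor_weight \<beta>) {k. (i, k) \<in> B}" for i
    by (metis digit_point_nth)
  then have "{k. (i, k) \<in> A} = {k. (i, k) \<in> B}" for i
    using inj_subset_sum_cantor[OF assms] by (simp add: inj_eq)
  then show "A = B" by (auto simp: set_eq_iff)
qed

lemma range_digit_point: "range (digit_point c) = {x. \<forall>i. x $ i \<in> range (subset_sum c)}"
proof (intro subset_antisym subsetI)
  fix x :: "real ^ 'n" assume "x \<in> {x. \<forall>i. x $ i \<in> range (subset_sum c)}"
  then have "\<forall>i. \<exists>S. x $ i = subset_sum c S" by auto
  then obtain S where S: "\<And>i. x $ i = subset_sum c (S i)" by metis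
  have "x = digit_point c {(i, k). k \<in> S i}" by (simp add: vec_eq_iff S)
  then show "x \<in> range (digit_point c)" by blast
qed auto

lemma hausdorff_null_binary_points:
  fixes T :: "('n::finite \<times> nat) set set"
  assumes \<beta>: "1 \<le> \<beta>" and \<gamma>: "0 < \<gamma>" "\<beta> * \<gamma> < 1"
    and null: "hausdorff_null s ((digit_point (cantor_weight \<beta>) :: _ \<Rightarrow> real ^ 'n) ` T)"
    and s: "0 < s" "0 \<le> t" "s \<le> \<gamma> * t"
  shows "hausdorff_null t ((digit_point binary_weight :: _ \<Rightarrow> real ^ 'n) ` T)"
proof -
  obtain K where K: "0 \<le> K"
    "\<And>S S'. \<bar>subset_sum binary_weight S - subset_sum binary_weight S'\<bar>
       \<le> K * \<bar>subset_sum (cantor_weight \<beta>) S - subset_sum (cantor_weight \<beta>) S'\<bar> powr \<gamma>"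
    using binary_holder_cantor[OF \<beta> \<gamma>] by metis
  show ?thesis
  proof (rule hausdorff_null_holder[OF null _ s, of "real CARD('n) * K"])
    fix A B :: "('n \<times> nat) set"
    let ?\<phi> = "digit_point (cantor_weight \<beta>) :: _ \<Rightarrow> real ^ 'n"
    let ?\<theta> = "digit_point binary_weight :: _ \<Rightarrow> real ^ 'n"
    have "dist (?\<theta> A) (?\<theta> B) \<le> (\<Sum>i\<in>UNIV. \<bar>?\<theta> A $ i - ?\<theta> B $ i\<bar>)" by (rule dist_le_sum_components)
    also have "\<dots> \<le> (\<Sum>i\<in>(UNIV::'n set). K * dist (?\<phi> A) (?\<phi> B) powr \<gamma>)"
    proof (rule sum_mono)
      fix i
      have "\<bar>?\<theta> A $ i - ?\<theta> B $ i\<bar> \<le> K * \<bar>?\<phi> A $ i - ?\<phi> B $ i\<bar> powr \<gamma>" using K(2) by simp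
      also have "\<bar>?\<phi> A $ i - ?\<phi> B $ i\<bar> \<le> dist (?\<phi> A) (?\<phi> B)"
        using dist_vec_nth_le[of "?\<phi> A" i "?\<phi> B"] by (simp add: dist_real_def)
      then have "K * \<bar>?\<phi> A $ i - ?\<phi> B $ i\<bar> powr \<gamma> \<le> K * dist (?\<phi> A) (?\<phi> B) powr \<gamma>"
        using K(1) \<gamma> by (intro mult_left_mono powr_mono2) auto
      finally show "\<bar>?\<theta> A $ i - ?\<theta> B $ i\<bar> \<le> K * dist (?\<phi> A) (?\<phi> B) powr \<gamma>" .
    qed
    also have "\<dots> = real CARD('n) * K * dist (?\<phi> A) (?\<phi> B) powr \<gamma>" by simp
    finally show "dist (?\<theta> A) (?\<theta> B) \<le> real CARD('n) * K * dist (?\<phi> A) (?\<phi> B) powr \<gamma>" .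
  qed (use K in auto)
qed

text \<open>The truncations at position \<open>k\<close> are centres of a cover. Since
  \<open>\<beta> * r = n\<close>, their number and the \<open>r\<close>-th power of the radius have
  exponential factors that cancel up to a constant, and the denominator
  \<open>(k + 2) powr r\<close> remains.\<close>

lemma hausdorff_null_cantor_points:
  assumes r: "0 < r" "r \<le> real CARD('n::finite)"
  shows "hausdorff_null r (range (digit_point (cantor_weight (real CARD('n) / r)) :: _ \<Rightarrow> real ^ 'n))"
proof (rule hausdorff_null_finite_covers[OF r(1)])
  fix e :: real assume e: "0 < e"
  define n where "n = real CARD('n)"
  define \<beta> where "\<beta> = n / r"
  have n: "0 < n" by (simp add: n_def)
  have \<beta>: "1 \<le> \<beta>" using r by (simp add: \<beta>_def n_def)
  let ?\<phi> = "digit_point (cantor_weight \<beta>) :: _ \<Rightarrow> real ^ 'n"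
  have "(\<lambda>k::nat. 2 powr n * n powr r / (real k + 2) powr r) \<longlonglongrightarrow> 0"
    using r(1) by real_asymp
  then obtain k :: nat where k: "2 powr n * n powr r / (real k + 2) powr r < e"
    using e by (metis (mono_tags, lifting) eventually_sequentially order_refl order_tendstoD(2))
  \<comment> \<open>Positions \<open>0\<close> to \<open>k\<close> give \<open>Suc k\<close> digits
    per coordinate, and the discarded tail starts at \<open>Suc k\<close>.\<close>
  define P where "P = ?\<phi> ` Pow (UNIV \<times> {..k})"
  define \<rho> where "\<rho> = n * (2 powr (- \<beta> * real k) / (real k + 2))"
  have "finite P" by (simp add: P_def)
  moreover have "0 \<le> \<rho>" using n by (simp add: \<rho>_def)
  moreover have "range ?\<phi> \<subseteq> (\<Union>p\<in>P. cball p \<rho>)"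
  proof clarify
    fix A :: "('n \<times> nat) set"
    let ?B = "A \<inter> (UNIV \<times> {..k})"
    have "dist (?\<phi> ?B) (?\<phi> A) \<le> (\<Sum>i\<in>UNIV. \<bar>?\<phi> ?B $ i - ?\<phi> A $ i\<bar>)" by (rule dist_le_sum_components)
    also have "\<dots> \<le> (\<Sum>i\<in>(UNIV::'n set). 2 powr (- \<beta> * real k) / (real k + 2))"
    proof (rule sum_mono)
      fix i
      have "\<bar>?\<phi> ?B $ i - ?\<phi> A $ i\<bar> \<le> (\<Sum>j. cantor_weight \<beta> (j + Suc k))"
        unfolding digit_point_nth
        by (rule subset_sum_diff_le_tail[OF cantor_weight_summable[OF \<beta>] less_imp_le[OF cantor_weight_pos]]) auto
      also have "\<dots> \<le> 2 powr (- \<beta> * real k) / (real k + 2)" by (rule cantor_weight_tail_le[OF \<beta>])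
      finally show "\<bar>?\<phi> ?B $ i - ?\<phi> A $ i\<bar> \<le> 2 powr (- \<beta> * real k) / (real k + 2)" .
    qed
    also have "\<dots> = \<rho>" by (simp add: \<rho>_def n_def)
    finally have "?\<phi> A \<in> cball (?\<phi> ?B) \<rho>" by simp
    moreover have "?\<phi> ?B \<in> P" unfolding P_def by (intro imageI) auto
    ultimately show "?\<phi> A \<in> (\<Union>p\<in>P. cball p \<rho>)" by blast
  qed
  moreover have "card P * \<rho> powr r < e"
  proof -
    have "card P \<le> card (Pow ((UNIV::'n set) \<times> {..k}))" unfolding P_def by (rule card_image_le) simp
    also have "\<dots> = 2 ^ (CARD('n) * Suc k)" by (simp add: card_Pow card_cartesian_product)
    finally have "real (card P) \<le> 2 ^ (CARD('n) * Suc k)" using of_nat_le_iff[where 'a=real] by fastforce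
    also have "\<dots> = 2 powr (n * (real k + 1))"
      by (simp add: n_def powr_realpow[symmetric] algebra_simps)
    finally have "card P * \<rho> powr r \<le> 2 powr (n * (real k + 1)) * \<rho> powr r"
      by (intro mult_right_mono) auto
    moreover have "\<rho> powr r = n powr r * 2 powr (- n * real k) / (real k + 2) powr r"
      using n r(1) by (simp add: \<rho>_def \<beta>_def powr_mult powr_divide powr_powr)
    moreover have "2 powr n = 2 powr (n * (real k + 1)) * 2 powr (- n * real k)"
      by (simp add: powr_add[symmetric] algebra_simps)
    ultimately have "card P * \<rho> powr r \<le> 2 powr n * n powr r / (real k + 2) powr r"
      by (simp add: mult_ac)
    then show ?thesis using k by linarith
  qed
  ultimately show "\<exists>P \<rho>. finite P \<and> 0 \<le> \<rho> \<and>
      range (digit_point (cantor_weight (real CARD('n) / r)) :: _ \<Rightarrow> real ^ 'n) \<subseteq> (\<Union>p\<in>P. cball p \<rho>)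
      \<and> real (card P) * \<rho> powr r < e"
    unfolding n_def \<beta>_def by blast
qed

section \<open>Fractals\<close>

lemma digit_point_binary_image:
  "{x :: real ^ 'n. \<forall>i. 0 \<le> x $ i \<and> x $ i < 1} \<subseteq> range (digit_point binary_weight)"
proof
  fix x :: "real ^ 'n" assume "x \<in> {x. \<forall>i. 0 \<le> x $ i \<and> x $ i < 1}"
  then have "x = digit_point binary_weight {(i, k). odd \<lfloor>x $ i * 2 ^ Suc k\<rfloor>}"
    using binary_expansion by (simp add: vec_eq_iff del: power_Suc)
  then show "x \<in> range (digit_point binary_weight)" by blast
qed

lemma digit_point_binary_image_no_zero:
  "{x :: real ^ 'n. \<forall>i. 0 \<le> x $ i \<and> x $ i < 1/2}
    \<subseteq> digit_point binary_weight ` {A. \<forall>i. (i, 0) \<notin> A}"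
proof
  fix x :: "real ^ 'n" assume x: "x \<in> {x. \<forall>i. 0 \<le> x $ i \<and> x $ i < 1/2}"
  let ?A = "{(i, k). odd \<lfloor>x $ i * 2 ^ Suc k\<rfloor>}"
  have "0 \<le> x $ i" "x $ i < 1" for i using x by (auto dest!: spec[of _ i])
  then have "x = digit_point binary_weight ?A"
    using binary_expansion by (simp add: vec_eq_iff del: power_Suc)
  moreover have "(i, 0) \<notin> ?A" for i
  proof -
    have "\<lfloor>x $ i * 2\<rfloor> = 0" using x by (auto simp: floor_eq_iff dest!: spec[of _ i])
    then show ?thesis by simp
  qed
  ultimately show "x \<in> digit_point binary_weight ` {A. \<forall>i. (i, 0) \<notin> A}" by blast
qed

text \<open>With \<open>\<gamma> = s / n\<close> the condition \<open>\<beta> * \<gamma> < 1\<close>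
  reads \<open>s < r\<close>, and \<open>s\<close>-null sets become \<open>n\<close>-null. The
  binary image contains a cube of positive volume, so it is not.\<close>

lemma not_hausdorff_null_cantor_half:
  fixes r s :: real
  assumes r: "0 < r" "r \<le> real CARD('n::finite)" and s: "0 < s" "s < r"
  shows "\<not> hausdorff_null s
    ((digit_point (cantor_weight (real CARD('n) / r)) :: _ \<Rightarrow> real ^ 'n) ` {A. \<forall>i. (i, 0) \<notin> A})"
proof
  assume "hausdorff_null s
    ((digit_point (cantor_weight (real CARD('n) / r)) :: _ \<Rightarrow> real ^ 'n) ` {A. \<forall>i. (i, 0) \<notin> A})"
  then have "hausdorff_null (real CARD('n))
      ((digit_point binary_weight :: _ \<Rightarrow> real ^ 'n) ` {A. \<forall>i. (i, 0) \<notin> A})"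
    by (rule hausdorff_null_binary_points[where \<gamma> = "s / real CARD('n)", rotated 3]) (use r s in auto)
  moreover have "cbox 0 ((\<chi> i. 1/4) :: real ^ 'n) \<subseteq> {x. \<forall>i. 0 \<le> x $ i \<and> x $ i < 1/2}"
  proof clarify
    fix x :: "real ^ 'n" and i assume "x \<in> cbox 0 (\<chi> i. 1/4)"
    then have "0 \<le> x $ i \<and> x $ i \<le> 1/4" by (simp add: mem_box_cart)
    then show "0 \<le> x $ i \<and> x $ i < 1/2" by linarith
  qed
  then have "cbox 0 ((\<chi> i. 1/4) :: real ^ 'n) \<subseteq> digit_point binary_weight ` {A. \<forall>i. (i, 0) \<notin> A}"
    using digit_point_binary_image_no_zero by (rule order_trans)
  ultimately have "hausdorff_null (real DIM(real ^ 'n)) (cbox 0 ((\<chi> i. 1/4) :: real ^ 'n))"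
    by (simp add: hausdorff_null_subset)
  then have "negligible (cbox 0 ((\<chi> i. 1/4) :: real ^ 'n))" by (rule hausdorff_null_imp_negligible)
  moreover have "(\<chi> i. 1/8) \<in> box 0 ((\<chi> i. 1/4) :: real ^ 'n)" by (simp add: mem_box_cart)
  ultimately show False unfolding negligible_interval by blast
qed

text \<open>For \<open>r = n\<close>, that is \<open>\<beta> = 1\<close>, the Cantor points are
  \<open>n\<close>-null; the exponent \<open>\<gamma> = n / t < 1\<close> carries this to the unit
  cube at exponent \<open>t\<close>. Scaling does the rest.\<close>

lemma hausdorff_null_cube:
  assumes t: "real CARD('n::finite) < t" and R: "0 < R"
  shows "hausdorff_null t (cbox 0 (\<chi> i. R) :: (real ^ 'n) set)"
proof -
  let ?n = "real CARD('n)"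
  let ?Q = "{x :: real ^ 'n. \<forall>i. 0 \<le> x $ i \<and> x $ i < 1}"
  have "hausdorff_null ?n (range (digit_point (cantor_weight 1) :: _ \<Rightarrow> real ^ 'n))"
    using hausdorff_null_cantor_points[of ?n, where 'n = 'n] by simp
  then have "hausdorff_null t (range (digit_point binary_weight :: _ \<Rightarrow> real ^ 'n))"
    by (rule hausdorff_null_binary_points[where \<gamma> = "?n / t", rotated 3])
       (use t of_nat_0_le_iff[of "CARD('n)", where 'a = real] in \<open>auto simp: divide_simps\<close>)
  then have Q: "hausdorff_null t ?Q" using digit_point_binary_image hausdorff_null_subset by blast
  have "0 < t" using t of_nat_0_le_iff[of "CARD('n)", where 'a = real] by linarith
  \<comment> \<open>The factor is \<open>2 * R\<close> because \<open>?Q\<close> is half-open, so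
    scaling by \<open>R\<close> would lose the upper faces.\<close>
  then have "hausdorff_null t ((\<lambda>x. (2 * R) *\<^sub>R x) ` ?Q)"
    using hausdorff_null_holder[of t "\<lambda>x. x" ?Q "2 * R" t 1 "\<lambda>x. (2 * R) *\<^sub>R x"] Q R
    by (simp add: dist_norm flip: scaleR_diff_right)
  moreover have "cbox 0 (\<chi> i. R) \<subseteq> (\<lambda>x. (2 * R) *\<^sub>R x) ` ?Q"
  proof
    fix x :: "real ^ 'n" assume x: "x \<in> cbox 0 (\<chi> i. R)"
    have "x = (2 * R) *\<^sub>R ((1 / (2 * R)) *\<^sub>R x)" using R by simp
    moreover have "(1 / (2 * R)) *\<^sub>R x \<in> ?Q"
    proof (clarsimp, intro conjI)
      fix i
      have "0 \<le> x $ i" "x $ i \<le> R" using x by (auto simp: mem_box_cart)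
      then show "0 \<le> x $ i / (2 * R)" "x $ i / (2 * R) < 1" using R by (auto simp: divide_simps)
    qed
    ultimately show "x \<in> (\<lambda>x. (2 * R) *\<^sub>R x) ` ?Q" by blast
  qed
  ultimately show ?thesis by (rule hausdorff_null_subset)
qed

section \<open>Lebesgue null sets and their complements\<close>

lemma negligible_cantor_points:
  assumes r: "0 < r" "r \<le> real CARD('n::finite)"
  shows "negligible (range (digit_point (cantor_weight (real CARD('n) / r)) :: _ \<Rightarrow> real ^ 'n))"
  using hausdorff_null_mono[OF hausdorff_null_cantor_points[OF r] r] by (intro hausdorff_null_imp_negligible) simp

text \<open>An interval inside \<open>A\<close> would put a nonempty open box inside the
  power.\<close>

lemma interior_eq_empty_of_negligible_power:
  assumes "negligible {x :: real ^ 'n. \<forall>i. x $ i \<in> A}"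
  shows "interior A = {}"
proof (rule ccontr)
  assume "\<not> ?thesis"
  then obtain x e where e: "0 < e" "ball x e \<subseteq> A" by (meson mem_interior ex_in_conv)
  have "box (\<chi> i. x - e) (\<chi> i. x + e) \<subseteq> {x :: real ^ 'n. \<forall>i. x $ i \<in> A}"
    using e(2) by (force simp: mem_box_cart ball_eq_greaterThanLessThan)
  then have "negligible (box (\<chi> i. x - e) (\<chi> i. x + e) :: (real ^ 'n) set)"
    using assms negligible_subset by blast
  moreover have "(\<chi> i. x) \<in> (box (\<chi> i. x - e) (\<chi> i. x + e) :: (real ^ 'n) set)"
    using e(1) by (simp add: mem_box_cart)
  ultimately show False unfolding negligible_interval by blast
qed

lemma negligible_coord_in_countable:
  assumes "countable D"
  shows "negligible {x :: real ^ 'n. \<exists>i. x $ i \<in> D}"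
proof -
  have "{x :: real ^ 'n. \<exists>i. x $ i \<in> D} = (\<Union>i. \<Union>d\<in>D. {x. x $ i = d})" by auto
  moreover have "negligible {x :: real ^ 'n. x $ i = d}" for i d
    using negligible_standard_hyperplane[of "axis i 1 :: real ^ 'n" d]
    by (simp add: axis_in_Basis_iff cart_eq_inner_axis)
  ultimately show ?thesis
    using assms unfolding negligible_iff_null_sets
    by (auto intro!: null_sets_UN' countable_finite)
qed

lemma eqpoll_union_images:
  fixes \<psi> :: "'a \<Rightarrow> 'b"
  assumes "inj \<psi>" "B \<inter> range \<psi> = {}"
  shows "range (\<lambda>S. B \<union> \<psi> ` S) \<approx> Pow (UNIV :: 'a set)"
proof -
  have "inj (\<lambda>S. B \<union> \<psi> ` S)"
  proof (rule injI)
    fix S S' assume "B \<union> \<psi> ` S = B \<union> \<psi> ` S'"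
    then have "(B \<union> \<psi> ` S) - B = (B \<union> \<psi> ` S') - B" by simp
    moreover have "(B \<union> \<psi> ` S) - B = \<psi> ` S" for S using assms(2) by blast
    ultimately show "S = S'" using assms(1) by (simp add: inj_image_eq_iff)
  qed
  then show ?thesis unfolding Pow_UNIV by (rule inj_on_image_eqpoll_self)
qed

text \<open>The digit \<open>1\<close> at position \<open>0\<close> keeps these points apart from those with vanishing leading digits.\<close>

definition marked_point :: "real \<Rightarrow> nat set \<Rightarrow> real ^ 'n" where
  "marked_point \<beta> G = digit_point (cantor_weight \<beta>) (UNIV \<times> insert 0 (Suc ` G))"

lemma inj_marked_point:
  assumes "1 \<le> \<beta>"
  shows "inj (marked_point \<beta> :: _ \<Rightarrow> real ^ 'n)"
proof (rule injI)
  fix G H assume "(marked_point \<beta> G :: real ^ 'n) = marked_point \<beta> H"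
  then have "(UNIV :: 'n set) \<times> insert 0 (Suc ` G) = UNIV \<times> insert 0 (Suc ` H)"
    unfolding marked_point_def by (rule injD[OF inj_digit_point_cantor[OF assms]])
  then have "insert 0 (Suc ` G) = insert 0 (Suc ` H)" by blast
  then have "Suc ` G = Suc ` H" by (simp add: insert_ident)
  then show "G = H" by (simp add: inj_image_eq_iff)
qed

theorem theorem3p4:
  fixes r l :: real
  assumes "r > 0" and "l \<ge> 0" and "\<lceil>r\<rceil> \<le> int CARD('n::finite)"
  shows "\<exists>\<F> :: (real ^ 'n) set set.
           \<F> \<approx> Pow (Pow (UNIV :: nat set)) \<and>
           (\<forall>F\<in>\<F>. fractal F \<and>
              F \<in> sets lebesgue \<and> emeasure lebesgue F = ennreal l \<and>
              dim_H F = ereal (indicator {0} l * r + indicator {0<..} l * real CARD('n)))"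
proof -
  have r: "0 < r" "r \<le> real CARD('n)" using assms(1,3) by (auto simp: ceiling_le_iff)
  define \<beta> where "\<beta> = real CARD('n) / r"
  have \<beta>: "1 \<le> \<beta>" using r by (simp add: \<beta>_def)
  define E where "E = range (digit_point (cantor_weight \<beta>) :: _ \<Rightarrow> real ^ 'n)"
  define A where "A = range (subset_sum (cantor_weight \<beta>))"
  have EA: "E = {x. \<forall>i. x $ i \<in> A}" unfolding E_def A_def by (rule range_digit_point)
  have nE: "negligible E" unfolding E_def \<beta>_def by (rule negligible_cantor_points[OF r])
  have iA: "interior A = {}" using nE unfolding EA by (rule interior_eq_empty_of_negligible_power)
  define \<psi> where "\<psi> = (marked_point \<beta> :: _ \<Rightarrow> real ^ 'n)"
  have inj\<psi>: "inj \<psi>" unfolding \<psi>_def by (rule inj_marked_point[OF \<beta>])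
  have \<psi>E: "range \<psi> \<subseteq> E" by (auto simp: \<psi>_def E_def marked_point_def)
  show ?thesis
  proof (cases "l = 0")
    case True
    define B where "B = (digit_point (cantor_weight \<beta>) :: _ \<Rightarrow> real ^ 'n) ` {A. \<forall>i. (i, 0) \<notin> A}"
    have BE: "B \<subseteq> E" by (auto simp: B_def E_def)
    have "B \<inter> range \<psi> = {}"
      using inj_digit_point_cantor[OF \<beta>, where 'n = 'n]
      by (auto simp: B_def \<psi>_def marked_point_def inj_eq)
    then have card: "range (\<lambda>S. B \<union> \<psi> ` S) \<approx> Pow (Pow (UNIV :: nat set))"
      using eqpoll_union_images[OF inj\<psi>] by simp
    have "fractal F \<and> F \<in> sets lebesgue \<and> emeasure lebesgue F = ennreal l \<and>
        dim_H F = ereal (indicator {0} l * r + indicator {0<..} l * real CARD('n))"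
      if "F \<in> range (\<lambda>S. B \<union> \<psi> ` S)" for F
    proof -
      \<comment> \<open>Only this sandwich is used from here on: \<open>B\<close> gives the lower
        bound on the dimension, \<open>E\<close> all upper bounds.\<close>
      have F: "B \<subseteq> F" "F \<subseteq> E" using that BE \<psi>E by auto
      have dH: "dim_H F = ereal r"
      proof (rule dim_H_eqI[OF r(1)])
        fix s assume "r < s"
        have "hausdorff_null r E" unfolding E_def \<beta>_def by (rule hausdorff_null_cantor_points[OF r])
        then have "hausdorff_null r F" using F(2) by (rule hausdorff_null_subset)
        then show "hausdorff_null s F" using r(1) less_imp_le[OF \<open>r < s\<close>] by (rule hausdorff_null_mono)
      next
        fix s assume "0 < s" "s < r"
        then show "\<not> hausdorff_null s F"
          using not_hausdorff_null_cantor_half[OF r, of s] hausdorff_null_subset[OF _ F(1), of s]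
          unfolding B_def \<beta>_def by blast
      qed
      have "dim_ind F \<le> 0" using F(2) iA unfolding EA by (rule dim_ind_le_0)
      moreover have "0 < ereal r" using r(1) by simp
      ultimately have "fractal F" unfolding fractal_def dH by (rule le_less_trans)
      \<comment> \<open>Completeness of Lebesgue measure makes \<open>F\<close> measurable for an
        arbitrary choice of \<open>S\<close>.\<close>
      have "negligible F" using nE F(2) by (rule negligible_subset)
      then have "F \<in> null_sets lebesgue" by (simp add: negligible_iff_null_sets)
      then show ?thesis
        using True dH \<open>fractal F\<close> by (simp add: null_sets_def)
    qed
    with card show ?thesis by blast
  next
    case False
    then have l: "0 < l" using assms(2) by simp
    let ?n = "CARD('n)"
    \<comment> \<open>As \<open>-A\<close> is dense, so is \<open>D\<close>. Coordinates of points
      of \<open>E\<close> lie in \<open>A\<close> and thus avoid \<open>D\<close> already, so one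
      zero-dimensionality argument serves both the cube part and the copy of the power set.\<close>
    obtain D where D: "countable D" "D \<subseteq> - A" "- A \<subseteq> closure D" by (rule separable)
    have "closure D = UNIV"
      using closure_mono[OF D(3)] iA by (auto simp: closure_complement)
    then have iD: "interior (- D) = {}" by (simp add: interior_complement)
    define a where "a = root ?n l"
    have a: "0 < a" "a ^ ?n = l" using l by (auto simp: a_def)
    define Q where "Q = cbox 0 (\<chi> i. a) - {x :: real ^ 'n. \<exists>i. x $ i \<in> D}"
    define B where "B = Q - range \<psi>"
    have "B \<inter> range \<psi> = {}" by (auto simp: B_def)
    then have card: "range (\<lambda>S. B \<union> \<psi> ` S) \<approx> Pow (Pow (UNIV :: nat set))"
      using eqpoll_union_images[OF inj\<psi>] by simp
    have n\<psi>: "negligible (range \<psi>)" using nE \<psi>E by (rule negligible_subset)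
    \<comment> \<open>A side length for which one cube contains both \<open>Q\<close> and all points
      of \<open>range \<psi>\<close>.\<close>
    define R where "R = max a (suminf (cantor_weight \<beta>))"
    have "fractal F \<and> F \<in> sets lebesgue \<and> emeasure lebesgue F = ennreal l \<and>
        dim_H F = ereal (indicator {0} l * r + indicator {0<..} l * real CARD('n))"
      if "F \<in> range (\<lambda>S. B \<union> \<psi> ` S)" for F
    proof -
      have F: "B \<subseteq> F" "F \<subseteq> Q \<union> range \<psi>" using that by (auto simp: B_def)
      \<comment> \<open>Whatever \<open>S\<close> is, \<open>F\<close> differs from the cube only in
        \<open>range \<psi>\<close> and in the hyperplanes over \<open>D\<close>, all null.\<close>
      have "negligible ((cbox 0 (\<chi> i. a) - F) \<union> (F - cbox 0 (\<chi> i. a)))"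
        by (rule negligible_subset[OF negligible_Un[OF n\<psi> negligible_coord_in_countable[OF D(1)]]])
           (use F in \<open>auto simp: B_def Q_def\<close>)
      note sym = this
      have Fm: "F \<in> lmeasurable" by (rule lmeasurable_negligible_symdiff[OF lmeasurable_cbox sym])
      have "measure lebesgue F = measure lebesgue (cbox 0 (\<chi> i. a) :: (real ^ 'n) set)"
        by (rule measure_negligible_symdiff[OF lmeasurable_cbox sym])
      moreover have "(0 :: real ^ 'n) \<in> cbox 0 (\<chi> i. a)" using a(1) by (simp add: mem_box_cart)
      then have "measure lebesgue (cbox 0 (\<chi> i. a) :: (real ^ 'n) set) = l"
        using a(2) by (subst measure_completion) (auto simp: content_cbox_if_cart)
      ultimately have mF: "measure lebesgue F = l" by simp
      have em: "emeasure lebesgue F = ennreal l" using Fm mF by (simp add: emeasure_eq_measure2)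
      have dH: "dim_H F = ereal (real ?n)"
      proof (rule dim_H_eqI)
        fix s assume s: "real ?n < s"
        have "range \<psi> \<subseteq> cbox 0 (\<chi> i. R)"
          using subset_sum_bounds[OF cantor_weight_summable[OF \<beta>] less_imp_le[OF cantor_weight_pos]]
          by (auto simp: \<psi>_def marked_point_def mem_box_cart R_def le_max_iff_disj)
        moreover have "Q \<subseteq> cbox 0 (\<chi> i. R)"
          by (auto simp: Q_def mem_box_cart R_def le_max_iff_disj)
        ultimately have "F \<subseteq> cbox 0 (\<chi> i. R)" using F(2) by blast
        moreover have "0 < R" using a(1) by (simp add: R_def less_max_iff_disj)
        ultimately show "hausdorff_null s F"
          by (intro hausdorff_null_subset[OF hausdorff_null_cube[OF s]])
      next
        fix s assume s: "0 < s" "s < real ?n"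
        show "\<not> hausdorff_null s F"
        proof
          assume "hausdorff_null s F"
          \<comment> \<open>Positive volume alone excludes exponents below \<open>n\<close>, since a
            null set at a smaller exponent is \<open>n\<close>-null.\<close>
          then have "hausdorff_null (real DIM(real ^ 'n)) F" using s by (auto elim: hausdorff_null_mono)
          then have "negligible F" by (rule hausdorff_null_imp_negligible)
          then have "measure lebesgue F = 0" by (rule negligible_imp_measure0)
          with mF l show False by simp
        qed
      qed simp
      have "Q \<union> range \<psi> \<subseteq> {x. \<forall>i. x $ i \<in> - D}" using \<psi>E D(2) unfolding EA by (auto simp: Q_def)
      then have "F \<subseteq> {x. \<forall>i. x $ i \<in> - D}" using F(2) by (rule order_trans[rotated])
      then have "dim_ind F \<le> 0" using iD by (rule dim_ind_le_0)
      moreover have "0 < ereal (real ?n)" by simp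
      ultimately have "fractal F" unfolding fractal_def dH by (rule le_less_trans)
      then show ?thesis using Fm em dH l by (auto simp: fmeasurable_def)
    qed
    with card show ?thesis by blast
  qed
qed

end
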